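(* Let $N \ge 1$ be an integer, $1 \le p < +\infty$, and $-1 < \gamma < 0$. There exists a non-zero function $u \in BV(\mathbb{R}^N)$ with compact support such that $$\lim_{\lambda \to 0_+} \Phi_\lambda(u) = 0.$$
   Context: Functions are real-valued. For a measurable function $u$ on $\mathbb{R}^N$ and $\lambda>0$, and for the given $p$ and $\gamma$, $$\Phi_\lambda(u) = \lambda^p \iint_{\{(x,y)\in \mathbb{R}^N\times\mathbb{R}^N:\ |u(x)-u(y)|/|x-y|^{1+\gamma/p} > \lambda\}} |x-y|^{-N+\gamma}\,dx\,dy \in [0,+\infty].$$ "Non-zero" means not equal to $0$ almost everywhere. *)

theory Defs
  imports "HOL-Analysis.Analysis"
begin

definition has_compact_support :: "('a::topological_space \<Rightarrow> 'b::monoid_add) \<Rightarrow> bool" where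
  "has_compact_support f \<longleftrightarrow> compact (closure (support_on UNIV f))"

text \<open>The vector fields of class \<open>C\<^sup>1\<^sub>c\<close>. On a finite-dimensional space, continuity of the
  derivative is the same as continuity of each directional derivative.\<close>

definition C1_compact_fields :: "('a::euclidean_space \<Rightarrow> 'a) set" where
  "C1_compact_fields =
     {\<phi>. (\<forall>x. \<phi> differentiable (at x)) \<and>
         (\<forall>v. continuous_on UNIV (\<lambda>x. frechet_derivative \<phi> (at x) v)) \<and>
         has_compact_support \<phi>}"

definition divergence :: "('a::euclidean_space \<Rightarrow> 'a) \<Rightarrow> 'a \<Rightarrow> real" where
  "divergence \<phi> x = (\<Sum>b\<in>Basis. frechet_derivative \<phi> (at x) b \<bullet> b)"

text \<open>For integrable \<open>u\<close>, the total mass \<open>\<bar>Du\<bar>(\<real>\<^sup>N)\<close> of the distributional gradient. The integrals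
  are then genuine, since the divergence of a test field is bounded and continuous.\<close>

definition total_variation :: "('a::euclidean_space \<Rightarrow> real) \<Rightarrow> ereal" where
  "total_variation u =
     (SUP \<phi>\<in>{\<phi>\<in>C1_compact_fields. \<forall>x. norm (\<phi> x) \<le> 1}.
        ereal (\<integral>x. u x * divergence \<phi> x \<partial>lebesgue))"

definition BV :: "('a::euclidean_space \<Rightarrow> real) set" where
  "BV = {u. integrable lebesgue u \<and> total_variation u < \<infinity>}"

text \<open>The integral is over \<open>\<real>\<^sup>N \<times> \<real>\<^sup>N\<close> with its \<open>2N\<close>-dimensional Lebesgue measure. The diagonal
  \<open>x = y\<close>, where the quotient is \<open>0 / 0 = 0\<close>, is a null set.\<close>

definition Phi :: "real \<Rightarrow> real \<Rightarrow> real \<Rightarrow> ('a::euclidean_space \<Rightarrow> real) \<Rightarrow> ennreal" where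
  "Phi p \<gamma> l u =
     ennreal (l powr p) *
     (\<integral>\<^sup>+ (x, y) \<in> {(x, y). \<bar>u x - u y\<bar> / norm (x - y) powr (1 + \<gamma> / p) > l}.
        ennreal (norm (x - y) powr (- real DIM('a) + \<gamma>)) \<partial>lebesgue)"

end

theory Submission
  imports Defs
begin

text \<open>Take for \<open>u\<close> the indicator of the closed unit ball. Only pairs with exactly one point in the
  ball enter \<open>\<Phi>\<^sub>\<lambda>(u)\<close>, so \<open>\<Phi>\<^sub>\<lambda>(u) \<le> \<lambda>\<^sup>p I\<close>, where \<open>I\<close> is the fractional perimeter of the ball of
  order \<open>-\<gamma>\<close>. Writing the kernel as a superposition of indicators of \<open>\<bar>x - y\<bar> \<le> t\<close>, the finiteness
  of \<open>I\<close> follows because a straddling pair at distance at most \<open>t\<close> has its inner point in the shell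
  \<open>1 - t < \<bar>x\<bar> \<le> 1\<close>, of measure \<open>O(min(1, t))\<close>. The same shell estimate bounds the difference
  quotients of the ball, which gives the bounded variation.\<close>

section \<open>Thin shells along the unit sphere\<close>

text \<open>For \<open>t > 1\<close> the removed ball has negative radius and is empty, so the shell
  is then the whole unit ball. This is why no upper bound on \<open>t\<close> is needed in the
  estimates and why \<open>min 1 t\<close> appears in them.\<close>

definition shell :: "real \<Rightarrow> 'a::euclidean_space set" where
  "shell t = cball 0 1 - cball 0 (1 - t)"

lemma shell_borel [measurable]: "shell t \<in> sets borel"
  unfolding shell_def by simp

text \<open>The reverse triangle inequality gives \<open>norm x \<ge> norm y - t > 1 - t\<close>.
  This places the inner point of a straddling pair.\<close>

lemma in_shellI:
  assumes "norm x \<le> 1" "norm (x - y) \<le> t" "\<not> norm y \<le> 1"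
  shows "x \<in> shell t"
  using assms norm_triangle_ineq2[of y x]
  by (auto simp: shell_def norm_minus_commute)

text \<open>With \<open>V\<close> the volume of the unit ball and \<open>N\<close> the dimension,
  the volume for \<open>t \<le> 1\<close> is \<open>V * (1 - (1 - t) ^ N)\<close>, which Bernoulli's
  inequality bounds by \<open>N * V * t\<close>. For larger \<open>t\<close> the bound is that of
  the full ball, and \<open>N \<ge> 1\<close> absorbs the missing factor.\<close>

lemma emeasure_shell_le:
  assumes "0 \<le> t"
  shows "emeasure lborel (shell t :: 'a::euclidean_space set) \<le> ennreal (DIM('a) * unit_ball_vol DIM('a) * min 1 t)"
proof (cases "t \<le> 1")
  case True
  have "emeasure lborel (shell t :: 'a set) =
      emeasure lborel (cball 0 1 :: 'a set) - emeasure lborel (cball 0 (1 - t) :: 'a set)"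
    unfolding shell_def
    by (rule emeasure_Diff) (use assms True in \<open>auto simp: emeasure_cball\<close>)
  also have "\<dots> = ennreal (unit_ball_vol DIM('a) - unit_ball_vol DIM('a) * (1 - t) ^ DIM('a))"
    using True by (simp add: emeasure_cball ennreal_minus)
  also have "\<dots> \<le> ennreal (DIM('a) * unit_ball_vol DIM('a) * t)"
  proof (rule ennreal_leI)
    have "1 - DIM('a) * t \<le> (1 - t) ^ DIM('a)"
      using Bernoulli_inequality[of "- t" "DIM('a)"] True by simp
    then have "unit_ball_vol DIM('a) * (1 - DIM('a) * t) \<le> unit_ball_vol DIM('a) * (1 - t) ^ DIM('a)"
      by (rule mult_left_mono) simp
    then show "unit_ball_vol DIM('a) - unit_ball_vol DIM('a) * (1 - t) ^ DIM('a)
        \<le> DIM('a) * unit_ball_vol DIM('a) * t"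
      by (simp add: algebra_simps)
  qed
  finally show ?thesis using True by (simp add: min_def)
next
  case False
  have "emeasure lborel (shell t :: 'a set) \<le> emeasure lborel (cball 0 1 :: 'a set)"
    by (rule emeasure_mono) (auto simp: shell_def)
  also have "\<dots> = ennreal (1 * unit_ball_vol DIM('a))"
    by (simp add: emeasure_cball)
  also have "\<dots> \<le> ennreal (DIM('a) * unit_ball_vol DIM('a))"
    by (intro ennreal_leI mult_right_mono) (auto simp: Suc_le_eq)
  finally show ?thesis using False by (simp add: min_def)
qed

section \<open>Finiteness of the fractional perimeter of the ball\<close>

text \<open>The inequality is strict at \<open>r = 0\<close>, where \<open>powr\<close> gives \<open>0\<close> on the left.\<close>

lemma powr_le_layer_cake:
  fixes a r :: real
  assumes "0 < a" "0 \<le> r"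
  shows "ennreal (r powr - a) \<le>
    (\<integral>\<^sup>+t. ennreal (a * t powr (- a - 1)) * indicator {t. 0 < t \<and> r \<le> t} t \<partial>lborel)"
proof (cases "r = 0")
  case False
  with assms have r: "0 < r" by simp
  have "((\<lambda>t. a * t powr (- a - 1)) has_integral a * (- (r powr (- a - 1 + 1)) / (- a - 1 + 1))) {r..}"
    by (intro has_integral_mult_right has_integral_powr_to_inf) (use assms r in auto)
  moreover have "a * (- (r powr (- a - 1 + 1)) / (- a - 1 + 1)) = r powr - a"
    using assms by simp
  ultimately have "ennreal (r powr - a) =
      (\<integral>\<^sup>+t. ennreal (a * t powr (- a - 1)) * indicator {r..} t \<partial>lborel)"
    using nn_integral_has_integral_lebesgue'[of "{r..}" "\<lambda>t. a * t powr (- a - 1)"] assms by simp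
  also have "{r..} = {t. 0 < t \<and> r \<le> t}" using r by auto
  finally show ?thesis by simp
qed simp

text \<open>The integral is split at \<open>1\<close>. Below, the integrand is
  \<open>t powr (- s)\<close>, integrable at \<open>0\<close> because \<open>s < 1\<close>; above,
  it is \<open>t powr (- s - 1)\<close>, integrable at infinity because
  \<open>s > 0\<close>.\<close>

lemma nn_integral_powr_min_finite:
  fixes s :: real
  assumes "0 < s" "s < 1"
  shows "(\<integral>\<^sup>+t. ennreal (t powr (- s - 1) * min 1 t) * indicator {0<..} t \<partial>lborel) < \<infinity>"
proof -
  have 1: "(\<integral>\<^sup>+t. ennreal (t powr (- s)) * indicator {0..1} t \<partial>lborel) = ennreal (1 powr (-s + 1) / (-s + 1))"
    by (intro nn_integral_has_integral_lebesgue' has_integral_powr_from_0) (use assms in auto)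
  have 2: "(\<integral>\<^sup>+t. ennreal (t powr (- s - 1)) * indicator {1..} t \<partial>lborel)
      = ennreal (- (1 powr (- s - 1 + 1)) / (- s - 1 + 1))"
    by (intro nn_integral_has_integral_lebesgue' has_integral_powr_to_inf) (use assms in auto)
  have "(\<integral>\<^sup>+t. ennreal (t powr (- s - 1) * min 1 t) * indicator {0<..} t \<partial>lborel) \<le>
     (\<integral>\<^sup>+t. ennreal (t powr (- s)) * indicator {0..1} t + ennreal (t powr (- s - 1)) * indicator {1..} t \<partial>lborel)"
  proof (rule nn_integral_mono)
    fix t :: real
    have "t powr (- s - 1) * t = t powr (- s)" if "0 < t"
      using that by (simp add: powr_diff)
    then show "ennreal (t powr (- s - 1) * min 1 t) * indicator {0<..} t \<le>
        ennreal (t powr (- s)) * indicator {0..1} t + ennreal (t powr (- s - 1)) * indicator {1..} t"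
      by (auto simp: indicator_def min_def)
  qed
  also have "\<dots> < \<infinity>"
    by (subst nn_integral_add) (auto simp: 1 2)
  finally show ?thesis .
qed

lemma sets_ball_straddling_pairs [measurable]:
  "{(x, y :: 'a::euclidean_space). norm (x - y) \<le> t \<and> (norm x \<le> 1) \<noteq> (norm y \<le> 1)}
    \<in> sets (borel \<Otimes>\<^sub>M borel)"
proof -
  have "{z :: 'a \<times> 'a \<in> space (borel \<Otimes>\<^sub>M borel). norm (fst z - snd z) \<le> t
      \<and> (norm (fst z) \<le> 1) \<noteq> (norm (snd z) \<le> 1)} \<in> sets (borel \<Otimes>\<^sub>M borel)"
    by measurable
  then show ?thesis by (simp add: space_pair_measure split_beta')
qed

text \<open>The inner point lies in \<open>shell t\<close> and the outer one in the ball of radius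
  \<open>t\<close> about it, so the bound is a product of two volumes. The factor 2 accounts for
  which of the two points is the inner one.\<close>

lemma emeasure_ball_straddling_pairs_le:
  assumes "0 \<le> t"
  shows "emeasure (lborel \<Otimes>\<^sub>M lborel)
      {(x, y :: 'a::euclidean_space). norm (x - y) \<le> t \<and> (norm x \<le> 1) \<noteq> (norm y \<le> 1)}
    \<le> ennreal (2 * DIM('a) * unit_ball_vol DIM('a) ^ 2 * min 1 t * t ^ DIM('a))"
    (is "emeasure _ ?D \<le> _")
proof -
  let ?V = "unit_ball_vol DIM('a)"
  let ?K = "(DIM('a) * ?V * min 1 t) * (?V * t ^ DIM('a))"
  have K: "0 \<le> ?K" using assms by simp
  \<comment> \<open>\<open>f\<close> covers the pairs whose inner point is \<open>x\<close>, and
    \<open>g\<close> those whose inner point is \<open>y\<close>; their sum dominates the indicator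
    of \<open>?D\<close>.\<close>
  define f g :: "'a \<times> 'a \<Rightarrow> ennreal" where
    "f = (\<lambda>(x, y). indicator (shell t) x * indicator {z. dist (fst z) (snd z) \<le> t} (x, y))" and
    "g = (\<lambda>(x, y). indicator (shell t) y * indicator {z. dist (snd z) (fst z) \<le> t} (x, y))"
  have [measurable]: "f \<in> borel_measurable (lborel \<Otimes>\<^sub>M lborel)" "g \<in> borel_measurable (lborel \<Otimes>\<^sub>M lborel)"
    unfolding f_def g_def by measurable
  have slice: "(\<integral>\<^sup>+x. indicator (shell t :: 'a set) x * (\<integral>\<^sup>+y. indicator (cball x t) y \<partial>lborel) \<partial>lborel) \<le> ennreal ?K"
  proof -
    have "(\<integral>\<^sup>+x. indicator (shell t :: 'a set) x * (\<integral>\<^sup>+y. indicator (cball x t) y \<partial>lborel) \<partial>lborel)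
       = emeasure lborel (shell t :: 'a set) * ennreal (?V * t ^ DIM('a))"
      using assms by (simp add: emeasure_cball nn_integral_multc)
    also have "\<dots> \<le> ennreal (DIM('a) * ?V * min 1 t) * ennreal (?V * t ^ DIM('a))"
      by (intro mult_right_mono emeasure_shell_le assms) simp
    also have "\<dots> = ennreal ?K"
      using assms by (intro ennreal_mult[symmetric]) auto
    finally show ?thesis .
  qed
  have "(\<integral>\<^sup>+z. f z \<partial>(lborel \<Otimes>\<^sub>M lborel)) = (\<integral>\<^sup>+x. \<integral>\<^sup>+y. f (x, y) \<partial>lborel \<partial>lborel)"
    by (rule sigma_finite_measure.nn_integral_fst[OF sigma_finite_lborel, symmetric]) measurable
  also have "\<dots> = (\<integral>\<^sup>+x. indicator (shell t :: 'a set) x * (\<integral>\<^sup>+y. indicator (cball x t) y \<partial>lborel) \<partial>lborel)"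
    by (intro nn_integral_cong)
      (auto simp: f_def nn_integral_cmult[symmetric] indicator_def simp del: nn_integral_indicator intro!: nn_integral_cong)
  finally have f: "(\<integral>\<^sup>+z. f z \<partial>(lborel \<Otimes>\<^sub>M lborel)) \<le> ennreal ?K" using slice by simp
  \<comment> \<open>Integrating over \<open>x\<close> first makes the inner integral the volume of a
    ball about the shell point \<open>y\<close>, so \<open>slice\<close> applies again.\<close>
  have "(\<integral>\<^sup>+z. g z \<partial>(lborel \<Otimes>\<^sub>M lborel)) = (\<integral>\<^sup>+y. \<integral>\<^sup>+x. g (x, y) \<partial>lborel \<partial>lborel)"
    by (rule lborel_pair.nn_integral_snd[symmetric]) measurable
  also have "\<dots> = (\<integral>\<^sup>+x. indicator (shell t :: 'a set) x * (\<integral>\<^sup>+y. indicator (cball x t) y \<partial>lborel) \<partial>lborel)"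
    by (intro nn_integral_cong)
      (auto simp: g_def nn_integral_cmult[symmetric] indicator_def simp del: nn_integral_indicator intro!: nn_integral_cong)
  finally have g: "(\<integral>\<^sup>+z. g z \<partial>(lborel \<Otimes>\<^sub>M lborel)) \<le> ennreal ?K" using slice by simp
  have "emeasure (lborel \<Otimes>\<^sub>M lborel) ?D = (\<integral>\<^sup>+z. indicator ?D z \<partial>(lborel \<Otimes>\<^sub>M lborel))"
    by (rule nn_integral_indicator[symmetric]) (use sets_ball_straddling_pairs in simp)
  also have "\<dots> \<le> (\<integral>\<^sup>+z. f z + g z \<partial>(lborel \<Otimes>\<^sub>M lborel))"
  proof (rule nn_integral_mono)
    fix z :: "'a \<times> 'a"
    show "indicator ?D z \<le> f z + g z"
      using in_shellI[of "fst z" "snd z" t] in_shellI[of "snd z" "fst z" t]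
      by (cases z) (auto simp: f_def g_def indicator_def dist_norm norm_minus_commute)
  qed
  also have "\<dots> \<le> ennreal ?K + ennreal ?K"
    using add_mono[OF f g] by (simp add: nn_integral_add)
  also have "\<dots> = ennreal (?K + ?K)"
    by (rule ennreal_plus[symmetric]) (use K in auto)
  finally show ?thesis by (simp add: power2_eq_square mult_ac)
qed

text \<open>By Tonelli, the layer-cake formula for the kernel turns the integral into one over
  \<open>t\<close>, of the weight \<open>t powr (- N - s - 1)\<close> against the measure of the
  straddling pairs, which is at most a multiple of \<open>min 1 t * t ^ N\<close>. The powers with
  exponent \<open>N\<close> cancel and a convergent one-dimensional integral is left.\<close>

lemma nn_integral_ball_straddling_kernel_finite:
  fixes s :: real
  assumes s: "0 < s" "s < 1"
  shows "(\<integral>\<^sup>+z. ennreal (norm (fst z - snd z) powr (- real DIM('a) - s)) *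
      indicator {z. (norm (fst z) \<le> 1) \<noteq> (norm (snd z) \<le> 1)} z
      \<partial>(lborel \<Otimes>\<^sub>M lborel :: ('a::euclidean_space \<times> 'a) measure)) < \<infinity>"
    (is "(\<integral>\<^sup>+z. ?k z * indicator ?S z \<partial>_) < _")
proof -
  interpret P: pair_sigma_finite "lborel :: 'a measure" "lborel :: 'a measure" ..
  \<comment> \<open>The two factors here are the space of pairs \<open>z\<close> and the line of the
    parameter \<open>t\<close>, whose integrals are exchanged below.\<close>
  interpret pair_sigma_finite "lborel \<Otimes>\<^sub>M lborel :: ('a \<times> 'a) measure" "lborel :: real measure" ..
  let ?M = "lborel \<Otimes>\<^sub>M lborel :: ('a \<times> 'a) measure"
  define a where "a = DIM('a) + s"
  have a: "0 < a" using s by (simp add: a_def)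
  define C where "C = 2 * DIM('a) * unit_ball_vol DIM('a) ^ 2"
  have C: "0 \<le> C" by (simp add: C_def)
  let ?w = "\<lambda>t. ennreal (a * t powr (- a - 1))"
  let ?D = "\<lambda>t. {(x :: 'a, y). norm (x - y) \<le> t \<and> (norm x \<le> 1) \<noteq> (norm y \<le> 1)}"
  define f where "f = (\<lambda>(z, t). ?w t * indicator {p. 0 < snd p \<and> norm (fst (fst p) - snd (fst p)) \<le> snd p} (z, t)
      * indicator ?S z)"
  have [measurable]: "f \<in> borel_measurable (?M \<Otimes>\<^sub>M lborel)"
    unfolding f_def by measurable
  have "(\<integral>\<^sup>+z. ?k z * indicator ?S z \<partial>?M) \<le> (\<integral>\<^sup>+z. (\<integral>\<^sup>+t. f (z, t) \<partial>lborel) \<partial>?M)"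
  proof (rule nn_integral_mono)
    fix z :: "'a \<times> 'a"
    have "?k z \<le> (\<integral>\<^sup>+t. ?w t * indicator {t. 0 < t \<and> norm (fst z - snd z) \<le> t} t \<partial>lborel)"
      using powr_le_layer_cake[OF a, of "norm (fst z - snd z)"] by (simp add: a_def)
    then have "?k z * indicator ?S z \<le>
        (\<integral>\<^sup>+t. ?w t * indicator {t. 0 < t \<and> norm (fst z - snd z) \<le> t} t \<partial>lborel) * indicator ?S z"
      by (rule mult_right_mono) simp
    also have "\<dots> = (\<integral>\<^sup>+t. ?w t * indicator {t. 0 < t \<and> norm (fst z - snd z) \<le> t} t * indicator ?S z \<partial>lborel)"
      by (rule nn_integral_multc[symmetric]) measurable
    also have "\<dots> = (\<integral>\<^sup>+t. f (z, t) \<partial>lborel)"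
      by (intro nn_integral_cong) (auto simp: f_def indicator_def)
    finally show "?k z * indicator ?S z \<le> (\<integral>\<^sup>+t. f (z, t) \<partial>lborel)" .
  qed
  also have "\<dots> = (\<integral>\<^sup>+t. (\<integral>\<^sup>+z. f (z, t) \<partial>?M) \<partial>lborel)"
    by (rule Fubini[symmetric]) measurable
  also have "\<dots> \<le> (\<integral>\<^sup>+t. ennreal (a * C) * (ennreal (t powr (- s - 1) * min 1 t) * indicator {0<..} t) \<partial>lborel)"
  proof (rule nn_integral_mono)
    fix t :: real
    show "(\<integral>\<^sup>+z. f (z, t) \<partial>?M) \<le> ennreal (a * C) * (ennreal (t powr (- s - 1) * min 1 t) * indicator {0<..} t)"
    proof (cases "0 < t")
      case True
      have "(\<integral>\<^sup>+z. f (z, t) \<partial>?M) = (\<integral>\<^sup>+z. ?w t * indicator (?D t) z \<partial>?M)"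
        using True by (intro nn_integral_cong) (auto simp: f_def indicator_def)
      also have "\<dots> = ?w t * emeasure ?M (?D t)"
        by (rule nn_integral_cmult_indicator) (use sets_ball_straddling_pairs in simp)
      also have "\<dots> \<le> ?w t * ennreal (C * min 1 t * t ^ DIM('a))"
        unfolding C_def using True by (intro mult_left_mono emeasure_ball_straddling_pairs_le) auto
      also have "\<dots> = ennreal (a * t powr (- a - 1) * (C * min 1 t * t ^ DIM('a)))"
        using a C True by (intro ennreal_mult[symmetric]) auto
      also have "a * t powr (- a - 1) * (C * min 1 t * t ^ DIM('a)) = a * C * (t powr (- s - 1) * min 1 t)"
      proof -
        have "t powr (- a - 1) * t ^ DIM('a) = t powr (- a - 1 + DIM('a))"
          using True by (simp add: powr_add powr_realpow)
        also have "- a - 1 + DIM('a) = - s - 1" by (simp add: a_def)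
        finally show ?thesis by (simp add: mult_ac)
      qed
      also have "ennreal \<dots> = ennreal (a * C) * ennreal (t powr (- s - 1) * min 1 t)"
        using a C True by (intro ennreal_mult) auto
      finally show ?thesis using True by simp
    qed (simp add: f_def)
  qed
  also have "\<dots> = ennreal (a * C) * (\<integral>\<^sup>+t. ennreal (t powr (- s - 1) * min 1 t) * indicator {0<..} t \<partial>lborel)"
    by (rule nn_integral_cmult) measurable
  also have "\<dots> < \<infinity>"
    using nn_integral_powr_min_finite[OF s] by (simp add: ennreal_mult_less_top)
  finally show ?thesis .
qed

section \<open>Bounded variation of the indicator of the ball\<close>

lemma integral_lborel_translate:
  fixes f :: "'a::euclidean_space \<Rightarrow> real"
  assumes "f \<in> borel_measurable borel"
  shows "(\<integral>x. f (c + x) \<partial>lborel) = (\<integral>x. f x \<partial>lborel)"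
  using integral_distr[of "(+) c" lborel borel f] assms by (simp add: lborel_distr_plus)

text \<open>Moving the translation from \<open>g\<close> to the ball leaves two shells of thickness \<open>h\<close>.\<close>

lemma integral_ball_increment_le:
  fixes g :: "'a::euclidean_space \<Rightarrow> real" and b :: 'a
  assumes g: "continuous_on UNIV g" and le: "\<And>x. \<bar>g x\<bar> \<le> 1" and b: "norm b = 1" and h: "0 \<le> h"
  shows "\<bar>\<integral>x. indicator (cball 0 1) x * (g (x + h *\<^sub>R b) - g x) \<partial>lborel\<bar>
    \<le> 2 * DIM('a) * unit_ball_vol DIM('a) * h"
proof -
  let ?u = "indicat_real (cball 0 1 :: 'a set)"
  let ?c = "h *\<^sub>R b"
  let ?m = "measure lborel (shell h :: 'a set)"
  have [measurable]: "g \<in> borel_measurable borel"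
    using g by (rule borel_measurable_continuous_onI)
  have fin: "emeasure lborel (shell h :: 'a set) < \<infinity>"
    using emeasure_shell_le[OF h, where 'a='a] by (simp add: le_less_trans)
  have "?m \<le> DIM('a) * unit_ball_vol DIM('a) * min 1 h"
    using emeasure_shell_le[OF h, where 'a='a] fin h
    by (simp add: emeasure_eq_ennreal_measure)
  also have "\<dots> \<le> DIM('a) * unit_ball_vol DIM('a) * h"
    by (intro mult_left_mono) auto
  finally have m: "?m \<le> DIM('a) * unit_ball_vol DIM('a) * h" .
  have ball: "integrable lborel ?u"
    by (simp add: emeasure_cball)
  have shifted_ball: "integrable lborel (\<lambda>x. ?u (- ?c + x))"
    using ball integrable_distr_eq[of "(+) (- ?c)" lborel borel ?u] by (simp add: lborel_distr_plus)
  have int: "integrable lborel (\<lambda>x. w x * v x)" 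
    if "integrable lborel w" "v \<in> borel_measurable borel" "\<And>x. \<bar>v x\<bar> \<le> 1" for w v :: "'a \<Rightarrow> real"
    by (rule Bochner_Integration.integrable_bound[OF that(1)])
      (use that in \<open>auto simp: abs_mult intro!: mult_left_le\<close>)
  have "(\<integral>x. ?u x * (g (x + ?c) - g x) \<partial>lborel)
      = (\<integral>x. ?u x * g (x + ?c) \<partial>lborel) - (\<integral>x. ?u x * g x \<partial>lborel)"
    \<comment> \<open>Both products are integrable, as \<open>g\<close> is bounded and the ball has
      finite volume.\<close>
    unfolding right_diff_distrib
    by (intro Bochner_Integration.integral_diff int ball le) measurable
  also have "(\<integral>x. ?u x * g (x + ?c) \<partial>lborel) = (\<integral>x. ?u (- ?c + x) * g x \<partial>lborel)"
  proof -
    have [measurable]: "(\<lambda>x. ?u (- ?c + x)) \<in> borel_measurable borel"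
      by (rule measurable_compose[of "(+) (- ?c)" borel borel]) (auto intro: borel_measurable_indicator)
    have "(\<lambda>x. ?u (- ?c + x) * g x) \<in> borel_measurable borel"
      by measurable
    then show ?thesis
      using integral_lborel_translate[of "\<lambda>x. ?u (- ?c + x) * g x" ?c] by (simp add: add.commute)
  qed
  also have "(\<integral>x. ?u (- ?c + x) * g x \<partial>lborel) - (\<integral>x. ?u x * g x \<partial>lborel)
      = (\<integral>x. ?u (- ?c + x) * g x - ?u x * g x \<partial>lborel)"
    by (intro Bochner_Integration.integral_diff[symmetric] int ball shifted_ball le) measurable
  finally have "\<bar>\<integral>x. ?u x * (g (x + ?c) - g x) \<partial>lborel\<bar> = \<bar>\<integral>x. ?u (- ?c + x) * g x - ?u x * g x \<partial>lborel\<bar>"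
    by simp
  also have "\<dots> \<le> (\<integral>x. \<bar>?u (- ?c + x) * g x - ?u x * g x\<bar> \<partial>lborel)"
    by (rule integral_abs_bound)
  also have "\<dots> \<le> (\<integral>x. indicator (shell h) x + indicator (shell h) (- ?c + x) \<partial>lborel)"
  proof (rule integral_mono)
    show "integrable lborel (\<lambda>x. \<bar>?u (- ?c + x) * g x - ?u x * g x\<bar>)"
      by (intro integrable_abs Bochner_Integration.integrable_diff int ball shifted_ball le) measurable
    show "integrable lborel (\<lambda>x. indicator (shell h) x + indicator (shell h) (- ?c + x) :: real)"
      using fin integrable_distr_eq[of "(+) (- ?c)" lborel borel "indicat_real (shell h)"]
      by (simp add: lborel_distr_plus)
    fix x :: 'a
    \<comment> \<open>The points \<open>x\<close> and \<open>x - h *\<^sub>R b\<close> are at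
      distance \<open>h\<close>. When exactly one is in the ball, that one lies in the shell;
      otherwise the integrand vanishes.\<close>
    have "x \<in> shell h" if "norm x \<le> 1" "\<not> norm (- ?c + x) \<le> 1"
      using in_shellI[of x "- ?c + x" h] that b h by simp
    moreover have "- ?c + x \<in> shell h" if "\<not> norm x \<le> 1" "norm (- ?c + x) \<le> 1"
      using in_shellI[of "- ?c + x" x h] that b h by simp
    ultimately show "\<bar>?u (- ?c + x) * g x - ?u x * g x\<bar> \<le> indicator (shell h) x + indicator (shell h) (- ?c + x)"
      using le[of x] by (auto simp: indicator_def)
  qed
  also have "\<dots> = ?m + ?m"
  proof -
    have "integrable lborel (indicat_real (shell h :: 'a set))"
      using fin by simp
    moreover from this have "integrable lborel (\<lambda>x. indicat_real (shell h) (- ?c + x))"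
      using integrable_distr_eq[of "(+) (- ?c)" lborel borel "indicat_real (shell h)"]
      by (simp add: lborel_distr_plus)
    ultimately show ?thesis
      using integral_lborel_translate[of "indicat_real (shell h)" "- ?c"] by simp
  qed
  finally show ?thesis using m by simp
qed

text \<open>The partial derivative is the limit of difference quotients in direction
  \<open>b\<close>. The increment estimate divided by the step bounds their integrals independently
  of the step, and dominated convergence carries the bound to the limit.\<close>

lemma integral_ball_partial_derivative_le:
  fixes g :: "'a::euclidean_space \<Rightarrow> real" and g' :: "'a \<Rightarrow> 'a \<Rightarrow> real"
  assumes der: "\<And>x. (g has_derivative g' x) (at x)"
    and cont: "continuous_on UNIV (\<lambda>x. g' x b)"
    and le: "\<And>x. \<bar>g x\<bar> \<le> 1" and b: "norm b = 1"
  shows "\<bar>\<integral>x. indicator (cball 0 1) x * g' x b \<partial>lborel\<bar> \<le> 2 * DIM('a) * unit_ball_vol DIM('a)"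
proof -
  let ?u = "indicat_real (cball 0 1 :: 'a set)"
  have g: "continuous_on UNIV g"
    by (intro continuous_at_imp_continuous_on ballI) (rule has_derivative_continuous[OF der])
  have [measurable]: "g \<in> borel_measurable borel" "(\<lambda>x. g' x b) \<in> borel_measurable borel"
    using g cont by (auto intro: borel_measurable_continuous_onI)
  have [measurable]: "(cball 0 1 :: 'a set) \<in> sets borel" by simp
  \<comment> \<open>Linearity of the derivative reduces it on the line through \<open>x\<close> to
    multiplication by \<open>g' (x + t *\<^sub>R b) b\<close>, so the one-variable mean value
    theorem becomes available.\<close>
  have along: "((\<lambda>t. g (x + t *\<^sub>R b)) has_real_derivative g' (x + t *\<^sub>R b) b) (at t)" for x t
  proof -
    interpret linear "g' (x + t *\<^sub>R b)" using der has_derivative_linear by blast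
    have "((\<lambda>t. g (x + t *\<^sub>R b)) has_derivative (\<lambda>r. g' (x + t *\<^sub>R b) (r *\<^sub>R b))) (at t)"
      by (rule has_derivative_compose[of "\<lambda>t. x + t *\<^sub>R b", OF _ der]) (auto intro!: derivative_eq_intros)
    then show ?thesis
      by (simp add: has_field_derivative_def scale mult.commute[of _ "g' (x + t *\<^sub>R b) b"])
  qed
  \<comment> \<open>Radius 2 is enough: steps of length at most 1 from the unit ball stay inside.
    The mean value theorem then makes \<open>B\<close> a bound for all quotients, hence
    \<open>?u x * B\<close> an integrable majorant.\<close>
  have "compact ((\<lambda>x. g' x b) ` cball 0 2)"
    by (rule compact_continuous_image) (auto intro: continuous_on_subset[OF cont])
  then obtain B where "\<forall>x\<in>cball 0 2. \<bar>g' x b\<bar> \<le> B"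
    by (auto dest!: compact_imp_bounded simp: bounded_iff)
  then have B: "\<bar>g' x b\<bar> \<le> B" if "norm x \<le> 2" for x
    using that by simp
  have quot: "\<bar>(g (x + h *\<^sub>R b) - g x) / h\<bar> \<le> B" if x: "norm x \<le> 1" and h: "0 < h" "h \<le> 1" for x h
  proof -
    obtain t where t: "0 < t" "t < h" "g (x + h *\<^sub>R b) - g (x + 0 *\<^sub>R b) = (h - 0) * g' (x + t *\<^sub>R b) b"
      using MVT2[OF h(1), of "\<lambda>t. g (x + t *\<^sub>R b)" "\<lambda>t. g' (x + t *\<^sub>R b) b"] along by blast
    have "norm (x + t *\<^sub>R b) \<le> 2"
      using norm_triangle_ineq[of x "t *\<^sub>R b"] x t h b by simp
    with t h B show ?thesis by simp
  qed
  define h where "h n = 1 / real (Suc n)" for n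
  have h: "0 < h n" "h n \<le> 1" for n by (auto simp: h_def)
  have h0: "h \<longlonglongrightarrow> 0"
    unfolding h_def by (rule LIMSEQ_Suc) (rule lim_1_over_n)
  let ?s = "\<lambda>n x. ?u x * ((g (x + h n *\<^sub>R b) - g x) / h n)"
  have "(\<lambda>n. \<integral>x. ?s n x \<partial>lborel) \<longlonglongrightarrow> (\<integral>x. ?u x * g' x b \<partial>lborel)"
  proof (rule integral_dominated_convergence[where w = "\<lambda>x. ?u x * B"])
    show "integrable lborel (\<lambda>x. ?u x * B)"
      by (simp add: emeasure_cball)
    show "AE x in lborel. (\<lambda>n. ?s n x) \<longlonglongrightarrow> ?u x * g' x b"
    proof (rule AE_I2)
      fix x
      have "((\<lambda>t. (g (x + t *\<^sub>R b) - g x) / t) \<longlongrightarrow> g' x b) (at 0)"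
        using along[of x 0] by (simp add: DERIV_def)
      moreover have "filterlim h (at 0) sequentially"
        using h h0 by (auto simp: filterlim_at less_imp_neq[symmetric])
      ultimately show "(\<lambda>n. ?s n x) \<longlonglongrightarrow> ?u x * g' x b"
        by (intro tendsto_mult_left) (rule filterlim_compose)
    qed
    show "AE x in lborel. norm (?s n x) \<le> ?u x * B" for n
    proof (rule AE_I2)
      show "norm (?s n x) \<le> ?u x * B" for x
        using quot[of x "h n"] h[of n] by (cases "norm x \<le> 1") auto
    qed
  qed simp_all
  then have "(\<lambda>n. \<bar>\<integral>x. ?s n x \<partial>lborel\<bar>) \<longlonglongrightarrow> \<bar>\<integral>x. ?u x * g' x b \<partial>lborel\<bar>"
    by (rule tendsto_rabs)
  moreover have "\<bar>\<integral>x. ?s n x \<partial>lborel\<bar> \<le> 2 * DIM('a) * unit_ball_vol DIM('a)" for n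
  proof -
    have "\<bar>\<integral>x. ?s n x \<partial>lborel\<bar> = \<bar>\<integral>x. ?u x * (g (x + h n *\<^sub>R b) - g x) \<partial>lborel\<bar> / h n"
      using h[of n] by simp
    also have "\<dots> \<le> 2 * DIM('a) * unit_ball_vol DIM('a)"
      using integral_ball_increment_le[OF g le b, of "h n"] h[of n] by (simp add: divide_le_eq)
    finally show ?thesis .
  qed
  ultimately show ?thesis
    by (intro LIMSEQ_le_const2) auto
qed

text \<open>The divergence is a sum of \<open>DIM('a)\<close> partial derivatives of components of
  \<phi>, and each component is bounded by 1. Each therefore contributes at most \<open>?C\<close>,
  uniformly in \<phi>.\<close>

lemma indicator_cball_in_BV: "indicator (cball 0 1 :: 'a::euclidean_space set) \<in> BV"
proof -
  let ?u = "indicat_real (cball 0 1 :: 'a set)"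
  let ?C = "2 * DIM('a) * unit_ball_vol DIM('a)"
  have "integrable lebesgue ?u"
    by (subst integrable_completion) (auto simp: emeasure_cball intro: borel_measurable_indicator)
  moreover have "total_variation ?u \<le> ereal (DIM('a) * ?C)"
    unfolding total_variation_def
  proof (rule SUP_least, clarify)
    fix \<phi> :: "'a \<Rightarrow> 'a"
    assume "\<phi> \<in> C1_compact_fields" and le: "\<forall>x. norm (\<phi> x) \<le> 1"
    then have der: "(\<phi> has_derivative frechet_derivative \<phi> (at x)) (at x)"
      and cont: "continuous_on UNIV (\<lambda>x. frechet_derivative \<phi> (at x) v)" for x v
      by (auto simp: C1_compact_fields_def frechet_derivative_works)
    let ?d = "\<lambda>b x. frechet_derivative \<phi> (at x) b \<bullet> b"
    have d_cont: "continuous_on UNIV (?d b)" for b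
      by (intro continuous_intros cont)
    then have d_meas [measurable]: "?d b \<in> borel_measurable borel" for b
      by (rule borel_measurable_continuous_onI)
    have d_int: "integrable lborel (\<lambda>x. ?u x * ?d b x)" for b
      using borel_integrable_compact[of "cball 0 1" "?d b"] continuous_on_subset[OF d_cont]
      by (simp add: indicator_scaleR_eq_if indicator_times_eq_if)
    have d_le: "\<bar>\<integral>x. ?u x * ?d b x \<partial>lborel\<bar> \<le> ?C" if b: "b \<in> Basis" for b
    proof (rule integral_ball_partial_derivative_le[where g = "\<lambda>x. \<phi> x \<bullet> b" and
          g' = "\<lambda>x v. frechet_derivative \<phi> (at x) v \<bullet> b"])
      show "((\<lambda>x. \<phi> x \<bullet> b) has_derivative (\<lambda>v. frechet_derivative \<phi> (at x) v \<bullet> b)) (at x)" for x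
        by (intro has_derivative_inner_left der)
      show "\<bar>\<phi> x \<bullet> b\<bar> \<le> 1" for x
        using Basis_le_norm[OF b, of "\<phi> x"] le by (meson order_trans)
    qed (use b d_cont in auto)
    \<comment> \<open>The integrand is Borel measurable, so the completion does not change its
      integral.\<close>
    have "(\<integral>x. ?u x * divergence \<phi> x \<partial>lebesgue) = (\<integral>x. ?u x * divergence \<phi> x \<partial>lborel)"
      unfolding divergence_def
      by (intro integral_completion borel_measurable_times borel_measurable_indicator borel_measurable_sum)
        (use d_meas in auto)
    also have "\<dots> = (\<Sum>b\<in>Basis. \<integral>x. ?u x * ?d b x \<partial>lborel)"
      unfolding divergence_def sum_distrib_left by (rule Bochner_Integration.integral_sum) (rule d_int)
    also have "\<dots> \<le> (\<Sum>b\<in>(Basis :: 'a set). ?C)"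
      by (rule sum_mono) (use d_le in \<open>auto dest: abs_le_D1\<close>)
    finally show "ereal (\<integral>x. ?u x * divergence \<phi> x \<partial>lebesgue) \<le> ereal (DIM('a) * ?C)"
      by simp
  qed
  then have "total_variation ?u < \<infinity>"
    by (rule le_less_trans) simp
  ultimately show ?thesis by (simp add: BV_def)
qed

section \<open>Decay of \<open>Phi\<close> for small thresholds\<close>

text \<open>On pairs that do not straddle the sphere the quotient is 0 and cannot exceed
  \<open>l > 0\<close>. On all others the threshold is dropped, which leaves an integral independent
  of \<open>l\<close>.\<close>

lemma Phi_indicator_cball_le:
  assumes l: "0 < l"
  shows "Phi p \<gamma> l (indicator (cball 0 1 :: 'a::euclidean_space set)) \<le> ennreal (l powr p) *
    (\<integral>\<^sup>+z. ennreal (norm (fst z - snd z) powr (- real DIM('a) + \<gamma>)) *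
      indicator {z. (norm (fst z) \<le> 1) \<noteq> (norm (snd z) \<le> 1)} z
      \<partial>(lborel \<Otimes>\<^sub>M lborel :: ('a \<times> 'a) measure))"
  unfolding Phi_def nn_integral_completion lborel_prod
proof (rule mult_left_mono[OF nn_integral_mono zero_le])
  let ?u = "indicat_real (cball 0 1 :: 'a set)"
  let ?A = "{(x, y). l < \<bar>?u x - ?u y\<bar> / norm (x - y) powr (1 + \<gamma> / p)}"
  let ?S = "{z :: 'a \<times> 'a. (norm (fst z) \<le> 1) \<noteq> (norm (snd z) \<le> 1)}"
  have "?A \<subseteq> ?S"
  proof (rule subrelI)
    fix x y
    assume "(x, y) \<in> ?A"
    then have less: "l < \<bar>?u x - ?u y\<bar> / norm (x - y) powr (1 + \<gamma> / p)"
      by (simp only: mem_Collect_eq prod.case)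
    have "(norm x \<le> 1) \<noteq> (norm y \<le> 1)"
    proof
      assume "(norm x \<le> 1) = (norm y \<le> 1)"
      then have "?u x - ?u y = 0"
        by (cases "norm y \<le> 1") simp_all
      \<comment> \<open>The numerator is 0, so the quotient is 0 even at \<open>x = y\<close>, where
        the denominator vanishes as well.\<close>
      then have "l < 0"
        using less by (metis abs_zero div_0)
      with l show False by (rule less_asym)
    qed
    then show "(x, y) \<in> ?S" by (simp only: mem_Collect_eq fst_conv snd_conv) simp
  qed
  then have "indicator ?A z \<le> (indicator ?S z :: ennreal)" for z
    by (intro indicator_leI) (rule subsetD)
  then show "(case z of (x, y) \<Rightarrow> ennreal (norm (x - y) powr (- real DIM('a) + \<gamma>))) * indicator ?A z
     \<le> ennreal (norm (fst z - snd z) powr (- real DIM('a) + \<gamma>)) * indicator ?S z" for z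
    by (subst case_prod_beta) (rule mult_left_mono[OF _ zero_le])
qed

theorem proposition2p1:
  fixes p \<gamma> :: real
  assumes "1 \<le> p" and "-1 < \<gamma>" and "\<gamma> < 0"
  shows "\<exists>u :: real ^ 'n \<Rightarrow> real.
           u \<in> BV \<and> has_compact_support u \<and> \<not> (AE x in lebesgue. u x = 0) \<and>
           ((\<lambda>l. Phi p \<gamma> l u) \<longlongrightarrow> 0) (at_right 0)"
proof (intro exI conjI)
  let ?u = "indicat_real (cball 0 1 :: (real ^ 'n) set)"
  show "?u \<in> BV" by (rule indicator_cball_in_BV)
  have "support_on UNIV ?u = cball 0 1"
    by (auto simp: support_on_def indicator_def)
  then show "has_compact_support ?u"
    by (simp add: has_compact_support_def)
  show "\<not> (AE x in lebesgue. ?u x = 0)"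
  proof
    assume "AE x in lebesgue. ?u x = 0"
    then have "AE x in lebesgue. x \<notin> (cball 0 1 :: (real ^ 'n) set)"
      by (rule AE_mp) (auto simp: indicator_def)
    then have "cball 0 1 \<in> null_sets (lebesgue :: (real ^ 'n) measure)"
      by (subst AE_iff_null_sets) auto
    then have "emeasure lebesgue (cball 0 1 :: (real ^ 'n) set) = 0"
      by (rule null_setsD1)
    then show False
      using unit_ball_vol_pos[of "real CARD('n)"] by (simp add: emeasure_cball)
  qed
  define I where "I = (\<integral>\<^sup>+z. ennreal (norm (fst z - snd z) powr (- real DIM(real ^ 'n) + \<gamma>)) *
      indicator {z. (norm (fst z) \<le> 1) \<noteq> (norm (snd z) \<le> 1)} z
      \<partial>(lborel \<Otimes>\<^sub>M lborel :: ((real ^ 'n) \<times> (real ^ 'n)) measure))"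
  \<comment> \<open>The kernel estimate is used with \<open>s = - \<gamma>\<close>, which lies
    strictly between 0 and 1 exactly because \<gamma> lies strictly between -1 and 0.\<close>
  have "I < \<infinity>"
    unfolding I_def using nn_integral_ball_straddling_kernel_finite[of "- \<gamma>", where 'a="real ^ 'n"] assms by simp
  have "((\<lambda>l. l powr p) \<longlongrightarrow> 0) (at_right 0)"
    using assms tendsto_powr'[of "\<lambda>l. l" 0 "at_right 0" "\<lambda>_. p" p]
    by (auto simp: eventually_at_filter)
  then have "((\<lambda>l. ennreal (l powr p)) \<longlongrightarrow> ennreal 0) (at_right 0)"
    by (rule tendsto_ennrealI)
  \<comment> \<open>Finiteness of \<open>I\<close> makes multiplication by \<open>I\<close>
    continuous at 0 on the extended half-line.\<close>
  then have "((\<lambda>l. I * ennreal (l powr p)) \<longlongrightarrow> I * ennreal 0) (at_right 0)"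
    using \<open>I < \<infinity>\<close> by (intro ennreal_tendsto_cmult) simp_all
  then have lim: "((\<lambda>l. ennreal (l powr p) * I) \<longlongrightarrow> 0) (at_right 0)"
    by (simp add: mult.commute)
  show "((\<lambda>l. Phi p \<gamma> l ?u) \<longlongrightarrow> 0) (at_right 0)"
  proof (rule tendsto_sandwich[OF _ _ tendsto_const lim])
    show "\<forall>\<^sub>F l in at_right 0. Phi p \<gamma> l ?u \<le> ennreal (l powr p) * I"
      unfolding I_def using eventually_at_right_less[of 0]
      by eventually_elim (rule Phi_indicator_cball_le)
  qed simp
qed

end
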